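(* Let $n\ge 3$, $R>0$, $\theta_0\in(0,\pi)$, and let $\Omega=\{x\in\mathbb{R}^n: 0<r<R,\ 0\le\theta<\theta_0\}$ with conical boundary portion $\Gamma_{\mathrm{cone}}=\{0<r<R,\ \theta=\theta_0\}$. For $s\in(-\pi+\theta_0,\theta_0)$ consider the oblique derivative problem $$\Delta u=0\ \text{ in }\Omega,\qquad \beta\cdot Du=0\ \text{ on }\Gamma_{\mathrm{cone}},\qquad (\ast)$$ where $\beta=\sin(s)\,\partial_{r'}+\cos(s)\,\partial_{x_n}$, $r'=|x'|$. (i) Suppose that $\theta_0\in(\frac{\pi}{2},\pi)$. There exists $s_0\in(-\pi+\theta_0,0)$ depending on $\theta_0$ such that if either $s\in(-\pi+\theta_0,s_0)$ or $s\in(\frac{\pi}{2},\theta_0)$, then there exists a H\"older continuous axi-symmetric solution of $(\ast)$ which is not $C^1$ up to the origin. (ii) Suppose that $\theta_0\in(0,\frac{\pi}{2})$. There exists $s_0\in(-\frac{\pi}{2},0)$ depending on $\theta_0$ such that if $s\in(-\frac{\pi}{2},s_0)$, then there exists a H\"older continuous axi-symmetric solution of $(\ast)$ which is not $C^1$ up to the origin.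
   Context: Write $x=(x',x_n)\in\mathbb{R}^{n-1}\times\mathbb{R}$ and use polar coordinates $r=|x|$, $x_n=r\cos\theta$, $\theta\in[0,\pi]$. Axi-symmetric coordinates are $y_1=x_n=r\cos\theta$, $y_2=|x'|=r\sin\theta$; a function $u$ is axi-symmetric if it depends only on $(y_1,y_2)$. In these coordinates the boundary operator is $\beta\cdot Du=\cos(s)\,\partial_{y_1}u+\sin(s)\,\partial_{y_2}u$, i.e. $\beta$ corresponds to the constant vector $(\cos(s),\sin(s))$; the condition $s\in(-\pi+\theta_0,\theta_0)$ says exactly that $\beta$ points into $\Omega$ along $\Gamma_{\mathrm{cone}}$. No boundary condition is imposed on the spherical part $\{r=R\}$ of the boundary. *)

theory Defs
  imports "HOL-Analysis.Analysis"
begin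

text \<open>Points of \<open>\<real>\<^sup>n\<close> are pairs \<open>(x', x\<^sub>n)\<close> of type \<open>(real^'m) \<times> real\<close>, so \<open>n = CARD('m) + 1\<close>.\<close>

definition grad :: "('a::euclidean_space \<Rightarrow> real) \<Rightarrow> 'a \<Rightarrow> 'a" where
  "grad u x = (THE D. GDERIV u x :> D)"

definition laplacian :: "('a::euclidean_space \<Rightarrow> real) \<Rightarrow> 'a \<Rightarrow> real" where
  "laplacian u x = (\<Sum>b\<in>Basis. frechet_derivative (grad u) (at x) b \<bullet> b)"

text \<open>Meant for open sets \<open>\<Omega>\<close>: derivatives are taken in the full space.\<close>

definition C2_on :: "'a::euclidean_space set \<Rightarrow> ('a \<Rightarrow> real) \<Rightarrow> bool" where
  "C2_on \<Omega> u \<longleftrightarrow>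
     (\<forall>x\<in>\<Omega>. u differentiable (at x)) \<and>
     (\<forall>x\<in>\<Omega>. grad u differentiable (at x)) \<and>
     (\<forall>b\<in>Basis. continuous_on \<Omega> (\<lambda>x. frechet_derivative (grad u) (at x) b))"

text \<open>\<open>u \<in> C\<^sup>1(\<Omega> \<union> T)\<close> for an open set \<open>\<Omega>\<close> and \<open>T\<close> a subset of its boundary, with \<open>G\<close> the continuous
  extension to \<open>\<Omega> \<union> T\<close> of \<open>Du\<close>; as \<open>T \<subseteq> closure \<Omega>\<close>, \<open>G\<close> is uniquely determined on \<open>\<Omega> \<union> T\<close>.\<close>

definition C1_upto_with ::
    "'a::euclidean_space set \<Rightarrow> 'a set \<Rightarrow> ('a \<Rightarrow> real) \<Rightarrow> ('a \<Rightarrow> 'a) \<Rightarrow> bool" where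
  "C1_upto_with \<Omega> T u G \<longleftrightarrow>
     continuous_on (\<Omega> \<union> T) u \<and> continuous_on (\<Omega> \<union> T) G \<and> (\<forall>x\<in>\<Omega>. GDERIV u x :> G x)"

definition C1_upto :: "'a::euclidean_space set \<Rightarrow> 'a set \<Rightarrow> ('a \<Rightarrow> real) \<Rightarrow> bool" where
  "C1_upto \<Omega> T u \<longleftrightarrow> (\<exists>G. C1_upto_with \<Omega> T u G)"

definition holder_continuous_on :: "'a::metric_space set \<Rightarrow> ('a \<Rightarrow> real) \<Rightarrow> bool" where
  "holder_continuous_on S u \<longleftrightarrow>
     (\<exists>\<alpha> C. 0 < \<alpha> \<and> \<alpha> \<le> 1 \<and> (\<forall>x\<in>S. \<forall>y\<in>S. \<bar>u x - u y\<bar> \<le> C * dist x y powr \<alpha>))"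

text \<open>The angle \<open>\<theta> \<in> [0,\<pi>]\<close> with \<open>x\<^sub>n = r cos \<theta>\<close>; meaningful only for \<open>x \<noteq> 0\<close>.\<close>

definition polar_angle :: "(real^'m::finite) \<times> real \<Rightarrow> real" where
  "polar_angle x = arccos (snd x / norm x)"

definition cone_domain :: "real \<Rightarrow> real \<Rightarrow> ((real^'m::finite) \<times> real) set" where
  "cone_domain R \<theta>\<^sub>0 = {x. 0 < norm x \<and> norm x < R \<and> 0 \<le> polar_angle x \<and> polar_angle x < \<theta>\<^sub>0}"

definition cone_boundary :: "real \<Rightarrow> real \<Rightarrow> ((real^'m::finite) \<times> real) set" where
  "cone_boundary R \<theta>\<^sub>0 = {x. 0 < norm x \<and> norm x < R \<and> polar_angle x = \<theta>\<^sub>0}"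

text \<open>\<open>\<beta> = sin(s) \<partial>\<^sub>r\<^sub>' + cos(s) \<partial>\<^sub>x\<^sub>n\<close> with \<open>r' = |x'|\<close>: the unit vector of \<open>\<partial>\<^sub>r\<^sub>'\<close> is \<open>x'/|x'| = sgn x'\<close>,
  and \<open>x' \<noteq> 0\<close> on the conical boundary because \<open>0 < \<theta>\<^sub>0 < \<pi>\<close>.\<close>

definition beta :: "real \<Rightarrow> (real^'m::finite) \<times> real \<Rightarrow> (real^'m) \<times> real" where
  "beta s x = (sin s *\<^sub>R sgn (fst x), cos s)"

text \<open>Classical solutions, in \<open>C\<^sup>2(\<Omega>) \<inter> C\<^sup>1(\<Omega> \<union> \<Gamma>)\<close>. Nothing is required on the spherical part of
  the boundary or, as regards derivatives, at the origin.\<close>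

definition oblique_solution ::
    "real \<Rightarrow> real \<Rightarrow> real \<Rightarrow> ((real^'m::finite) \<times> real \<Rightarrow> real) \<Rightarrow> bool" where
  "oblique_solution R \<theta>\<^sub>0 s u \<longleftrightarrow>
     C2_on (cone_domain R \<theta>\<^sub>0) u \<and>
     (\<forall>x\<in>cone_domain R \<theta>\<^sub>0. laplacian u x = 0) \<and>
     (\<exists>Du. C1_upto_with (cone_domain R \<theta>\<^sub>0) (cone_boundary R \<theta>\<^sub>0) u Du \<and>
           (\<forall>x\<in>cone_boundary R \<theta>\<^sub>0. beta s x \<bullet> Du x = 0))"

definition axisymmetric_on ::
    "((real^'m::finite) \<times> real) set \<Rightarrow> ((real^'m) \<times> real \<Rightarrow> real) \<Rightarrow> bool" where
  "axisymmetric_on S u \<longleftrightarrow> (\<exists>f. \<forall>x\<in>S. u x = f (snd x) (norm (fst x)))"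

text \<open>An axi-symmetric solution, Holder continuous on the whole closure of the domain, which is
  not \<open>C\<^sup>1\<close> up to the origin.\<close>

definition singular_axisymmetric_solution ::
    "real \<Rightarrow> real \<Rightarrow> real \<Rightarrow> ((real^'m::finite) \<times> real \<Rightarrow> real) \<Rightarrow> bool" where
  "singular_axisymmetric_solution R \<theta>\<^sub>0 s u \<longleftrightarrow>
     oblique_solution R \<theta>\<^sub>0 s u \<and>
     holder_continuous_on (closure (cone_domain R \<theta>\<^sub>0)) u \<and>
     axisymmetric_on (closure (cone_domain R \<theta>\<^sub>0)) u \<and>
     \<not> C1_upto (cone_domain R \<theta>\<^sub>0) (insert 0 (cone_boundary R \<theta>\<^sub>0)) u"

end

theory Submission
  imports Defs "HOL-Real_Asymp.Real_Asymp"
begin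

text \<open>We look for \<open>u = r\<^sup>a \<phi>((1 - cos \<theta>) / 2)\<close> with \<open>0 < a < 1\<close>: such a function is Holder continuous
  with exponent \<open>a\<close>, and its derivative along the axis blows up like \<open>r\<^sup>a\<^sup>-\<^sup>1\<close>. Harmonicity is the
  hypergeometric equation for \<open>\<phi>\<close>, whose power series at \<open>0\<close> converges for \<open>\<theta> < \<pi>\<close>; this makes \<open>u\<close> smooth
  across the positive axis and across the conical boundary. The oblique condition becomes one equation
  in \<open>a\<close>. After division by \<open>a\<close> its left-hand side is continuous on \<open>[0,1]\<close>, equals \<open>cos s\<close> at \<open>a = 1\<close> and
  \<open>cos (\<theta>\<^sub>0 - s) + K sin (\<theta>\<^sub>0 - s)\<close> at \<open>a = 0\<close>, where \<open>K \<ge> 0\<close> depends only on \<open>\<theta>\<^sub>0\<close> and \<open>n\<close>. For the stated \<open>s\<close> these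
  have opposite signs, so there is a root in \<open>(0,1)\<close>; for \<open>\<theta>\<^sub>0 < \<pi> / 2\<close> this rests on \<open>K < tan \<theta>\<^sub>0\<close>.\<close>

subsection \<open>Homogeneous axially symmetric functions\<close>

text \<open>With \<open>e\<close> the unit vector of the axis, \<open>tilt e x = (1 - cos \<theta>) / 2\<close>; at \<open>x = 0\<close> it has the
  junk value \<open>1 / 2\<close>, which \<open>conic\<close> for \<open>p > 0\<close> ignores because \<open>0 powr p = 0\<close>.\<close>

definition tilt :: "'a::real_inner \<Rightarrow> 'a \<Rightarrow> real" where
  "tilt e x = (1 - (x \<bullet> e) / norm x) / 2"

definition conic :: "'a::real_inner \<Rightarrow> real \<Rightarrow> (real \<Rightarrow> real) \<Rightarrow> 'a \<Rightarrow> real" where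
  "conic e p g x = norm x powr p * g (tilt e x)"

lemma inner_div_norm_eq_tilt: "(x \<bullet> e) / norm x = 1 - 2 * tilt e x"
  by (simp add: tilt_def diff_divide_distrib)

lemma inner_eq_tilt: "x \<noteq> 0 \<Longrightarrow> x \<bullet> e = norm x * (1 - 2 * tilt e x)"
  by (simp flip: inner_div_norm_eq_tilt)

section \<open>Gradients of homogeneous axially symmetric functions\<close>

lemma GDERIV_norm_powr:
  fixes x :: "'a::real_inner"
  assumes "x \<noteq> 0"
  shows "GDERIV (\<lambda>x. norm x powr p) x :> (p * norm x powr (p - 2)) *\<^sub>R x"
proof -
  have "((\<lambda>r. r powr p) has_real_derivative p * norm x powr (p - 1)) (at (norm x))"
    using assms by (auto intro!: derivative_eq_intros simp: powr_diff)
  from GDERIV_DERIV_compose[OF GDERIV_norm[OF assms] this]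
  have "GDERIV (\<lambda>x. norm x powr p) x :> (p * norm x powr (p - 1)) *\<^sub>R sgn x" .
  moreover have "norm x powr (p - 1) / norm x = norm x powr (p - 2)"
    using assms by (simp add: powr_diff power2_eq_square)
  ultimately show ?thesis
    by (simp add: sgn_div_norm divide_inverse mult.assoc)
qed

lemma GDERIV_tilt:
  fixes x :: "'a::real_inner"
  assumes "x \<noteq> 0"
  shows "GDERIV (tilt e) x :> ((x \<bullet> e) / (2 * norm x ^ 3)) *\<^sub>R x - (1 / (2 * norm x)) *\<^sub>R e"
proof -
  have "(tilt e has_derivative
      (\<lambda>h. ((x \<bullet> e) * (h \<bullet> sgn x) / (norm x)\<^sup>2 - (h \<bullet> e) / norm x) / 2)) (at x)"
    unfolding tilt_def
    using assms
    by (auto intro!: derivative_eq_intros has_derivative_norm simp: field_simps power2_eq_square)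
  moreover have "((x \<bullet> e) * (h \<bullet> sgn x) / (norm x)\<^sup>2 - (h \<bullet> e) / norm x) / 2 =
     h \<bullet> (((x \<bullet> e) / (2 * norm x ^ 3)) *\<^sub>R x - (1 / (2 * norm x)) *\<^sub>R e)" for h
    using assms by (simp add: sgn_div_norm inner_diff_right field_simps power2_eq_square power3_eq_cube)
  ultimately show ?thesis
    unfolding gderiv_def by simp
qed

text \<open>Splitting the gradient along \<open>x\<close> and \<open>e\<close> leaves coefficients
  that are again of the form \<open>conic\<close>, of degrees \<open>p - 2\<close> and
  \<open>p - 1\<close>, so the same differentiation rule also yields the second derivatives.\<close>

definition conic_grad :: "'a::real_inner \<Rightarrow> real \<Rightarrow> (real \<Rightarrow> real) \<Rightarrow> (real \<Rightarrow> real) \<Rightarrow> 'a \<Rightarrow> 'a" where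
  "conic_grad e p g g' x =
     conic e (p - 2) (\<lambda>t. p * g t + (1 - 2 * t) / 2 * g' t) x *\<^sub>R x +
     conic e (p - 1) (\<lambda>t. - g' t / 2) x *\<^sub>R e"

lemma GDERIV_conic:
  fixes x :: "'a::real_inner"
  assumes "x \<noteq> 0" and "(g has_real_derivative g' (tilt e x)) (at (tilt e x))"
  shows "GDERIV (conic e p g) x :>
    conic_grad e p g g' x"
proof -
  have g: "GDERIV (\<lambda>x. g (tilt e x)) x :>
      g' (tilt e x) *\<^sub>R (((x \<bullet> e) / (2 * norm x ^ 3)) *\<^sub>R x - (1 / (2 * norm x)) *\<^sub>R e)"
    by (rule GDERIV_DERIV_compose[OF GDERIV_tilt[OF assms(1)] assms(2)])
  have p: "norm x powr (p - 1) = norm x powr p / norm x"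
    "norm x powr (p - 2) = norm x powr p / (norm x)\<^sup>2"
    using assms(1) by (simp_all add: powr_diff)
  have e: "(x \<bullet> e) / (2 * norm x ^ 3) = (1 - 2 * tilt e x) / (2 * (norm x)\<^sup>2)"
    using assms(1) by (simp add: inner_eq_tilt power3_eq_cube power2_eq_square)
  show ?thesis
    unfolding conic_def conic_grad_def
    by (rule GDERIV_subst[OF GDERIV_mult[OF GDERIV_norm_powr[OF assms(1)] g]])
      (use assms(1) in \<open>unfold e p, simp add: algebra_simps flip: scaleR_add_left\<close>,
        simp add: field_simps flip: scaleR_add_left)
qed

text \<open>Euler's identity for degree \<open>p\<close>: the two contributions of \<open>g'\<close>
  cancel.\<close>

lemma conic_grad_inner_self:
  assumes "x \<noteq> 0"
  shows "conic_grad e p g g' x \<bullet> x = p * conic e p g x"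
proof -
  have p: "norm x powr (p - 1) = norm x powr p / norm x"
    "norm x powr (p - 2) = norm x powr p / (norm x)\<^sup>2"
    using assms by (simp_all add: powr_diff)
  show ?thesis
    unfolding conic_grad_def conic_def p inner_add_left inner_scaleR_left inner_commute[of e x]
      inner_eq_tilt[OF assms] dot_square_norm
    using assms by (simp add: field_simps power2_eq_square)
qed

text \<open>The derivative along the axis. At tilt 0 only \<open>p * g 0\<close> survives, which
  exposes the blow-up at the origin; the same formula enters the Laplacian.\<close>

lemma conic_grad_inner_axis:
  assumes "x \<noteq> 0" and "norm e = 1"
  shows "conic_grad e p g g' x \<bullet> e =
    conic e (p - 1) (\<lambda>t. (1 - 2 * t) * p * g t - 2 * t * (1 - t) * g' t) x"
proof -
  have p: "norm x powr (p - 1) = norm x powr p / norm x"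
    "norm x powr (p - 2) = norm x powr p / (norm x)\<^sup>2"
    using assms by (simp_all add: powr_diff)
  have "e \<bullet> e = 1"
    using assms(2) by (simp add: dot_square_norm)
  then show ?thesis
    unfolding conic_grad_def conic_def p inner_add_left inner_scaleR_left
      inner_eq_tilt[OF assms(1)]
    using assms by (simp add: field_simps power2_eq_square)
qed

lemma continuous_on_conic:
  assumes "0 \<notin> S" and "\<And>x. x \<in> S \<Longrightarrow> isCont g (tilt e x)"
  shows "continuous_on S (conic e p g)"
proof -
  have t: "continuous_on S (tilt e)"
    unfolding tilt_def using assms(1) by (auto intro!: continuous_intros)
  have "continuous_on (tilt e ` S) g"
    using assms(2) by (auto intro: continuous_at_imp_continuous_on)
  from continuous_on_compose2[OF this t]
  have "continuous_on S (\<lambda>x. g (tilt e x))"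
    by auto
  then show ?thesis
    unfolding conic_def using assms(1) by (auto intro!: continuous_intros)
qed

lemma continuous_on_conic_grad:
  assumes "0 \<notin> S" and "\<And>x. x \<in> S \<Longrightarrow> isCont g (tilt e x)" "\<And>x. x \<in> S \<Longrightarrow> isCont g' (tilt e x)"
  shows "continuous_on S (conic_grad e p g g')"
  unfolding conic_grad_def using assms
  by (intro continuous_intros continuous_on_conic) auto

section \<open>Second derivatives and the Laplacian\<close>

lemma grad_eq: "GDERIV u x :> D \<Longrightarrow> grad u x = D"
  unfolding grad_def
proof (rule the_equality)
  fix D' assume "GDERIV u x :> D" "GDERIV u x :> D'"
  then have "(\<lambda>h. h \<bullet> D') = (\<lambda>h. h \<bullet> D)"
    unfolding gderiv_def by (rule has_derivative_unique[rotated])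
  then show "D' = D"
    by (metis vector_eq_ldot)
qed

text \<open>The Laplacian is the trace of the derivative of \<open>conic_grad\<close>, whose two
  coefficients are differentiated by \<open>GDERIV_conic\<close>. With \<open>m\<close> for the
  dimension minus 1, the resulting operator in \<open>t\<close> is the hypergeometric one with
  parameters \<open>-p\<close>, \<open>p + m - 1\<close> and \<open>m / 2\<close>.\<close>

lemma
  fixes e :: "'a::euclidean_space" and p :: real
  assumes e: "norm e = 1" and \<Omega>: "open \<Omega>" "0 \<notin> \<Omega>"
    and g: "\<And>x. x \<in> \<Omega> \<Longrightarrow> (g has_real_derivative g1 (tilt e x)) (at (tilt e x))"
    and g1: "\<And>x. x \<in> \<Omega> \<Longrightarrow> (g1 has_real_derivative g2 (tilt e x)) (at (tilt e x))"
    and g2: "\<And>x. x \<in> \<Omega> \<Longrightarrow> isCont g2 (tilt e x)"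
  shows C2_on_conic: "C2_on \<Omega> (conic e p g)"
    and laplacian_conic: "x \<in> \<Omega> \<Longrightarrow> laplacian (conic e p g) x =
      conic e (p - 2) (\<lambda>t. t * (1 - t) * g2 t + (real DIM('a) - 1) / 2 * (1 - 2 * t) * g1 t +
        p * (p + real DIM('a) - 2) * g t) x"
proof -
  define A where "A t = p * g t + (1 - 2 * t) / 2 * g1 t" for t
  define A1 where "A1 t = (p - 1) * g1 t + (1 - 2 * t) / 2 * g2 t" for t
  define B where "B t = - g1 t / 2" for t
  define B1 where "B1 t = - g2 t / 2" for t
  define D where "D x h = conic e (p - 2) A x *\<^sub>R h + (h \<bullet> conic_grad e (p - 2) A A1 x) *\<^sub>R x +
    (h \<bullet> conic_grad e (p - 1) B B1 x) *\<^sub>R e" for x h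
  have G: "GDERIV (conic e p g) x :> conic_grad e p g g1 x" if "x \<in> \<Omega>" for x
    using that \<Omega> by (intro GDERIV_conic g) auto
  have "(conic_grad e p g g1 has_derivative D x) (at x)" if x: "x \<in> \<Omega>" for x
  proof -
    have "x \<noteq> 0"
      using x \<Omega> by auto
    have "(A has_real_derivative A1 (tilt e x)) (at (tilt e x))"
      unfolding A_def A1_def
      by (auto intro!: derivative_eq_intros g g1 x simp: field_simps)
    from GDERIV_conic[where g' = A1, OF \<open>x \<noteq> 0\<close> this]
    have A: "(conic e (p - 2) A has_derivative (\<lambda>h. h \<bullet> conic_grad e (p - 2) A A1 x)) (at x)"
      by (simp add: gderiv_def)
    have "(B has_real_derivative B1 (tilt e x)) (at (tilt e x))"
      unfolding B_def B1_def by (auto intro!: derivative_eq_intros g1 x)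
    from GDERIV_conic[where g' = B1, OF \<open>x \<noteq> 0\<close> this]
    have B: "(conic e (p - 1) B has_derivative (\<lambda>h. h \<bullet> conic_grad e (p - 1) B B1 x)) (at x)"
      by (simp add: gderiv_def)
    have "conic_grad e p g g1 = (\<lambda>x. conic e (p - 2) A x *\<^sub>R x + conic e (p - 1) B x *\<^sub>R e)"
      by (simp add: fun_eq_iff conic_grad_def A_def[abs_def] B_def[abs_def])
    then show ?thesis
      by (auto intro!: derivative_eq_intros A B simp: D_def)
  qed
  moreover have "\<And>x. x \<in> \<Omega> \<Longrightarrow> conic_grad e p g g1 x = grad (conic e p g) x"
    using grad_eq[OF G] by simp
  \<comment> \<open>\<open>grad\<close> is known to agree with \<open>conic_grad\<close> only on
    \<open>\<Omega>\<close>; openness makes this enough to transfer the derivative.\<close>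
  ultimately have D: "(grad (conic e p g) has_derivative D x) (at x)" if "x \<in> \<Omega>" for x
    using \<Omega>(1) that by (blast intro: has_derivative_transform_within_open)
  then have D_eq: "frechet_derivative (grad (conic e p g)) (at x) = D x" if "x \<in> \<Omega>" for x
    using that by (metis frechet_derivative_at)
  have cont: "isCont g (tilt e x)" "isCont g1 (tilt e x)" if "x \<in> \<Omega>" for x
    using that g g1 by (blast intro: DERIV_isCont)+
  have "continuous_on \<Omega> (\<lambda>x. D x b)" for b
    unfolding D_def conic_grad_def A_def[abs_def] A1_def[abs_def] B_def[abs_def] B1_def[abs_def]
    by (intro continuous_intros continuous_on_conic cont g2 \<Omega>) auto
  then show "C2_on \<Omega> (conic e p g)"
    unfolding C2_on_def
    using G D by (auto simp: D_eq gderiv_def differentiable_def cong: continuous_on_cong)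
  assume x: "x \<in> \<Omega>"
  then have "x \<noteq> 0"
    using \<Omega> by auto
  let ?GA = "conic_grad e (p - 2) A A1 x" and ?GB = "conic_grad e (p - 1) B B1 x"
  have "laplacian (conic e p g) x = (\<Sum>b\<in>Basis. conic e (p - 2) A x * (b \<bullet> b) +
      (b \<bullet> ?GA) * (x \<bullet> b) + (b \<bullet> ?GB) * (e \<bullet> b))"
    unfolding laplacian_def D_eq[OF x] D_def
    by (simp add: inner_add_left)
  also have "\<dots> = real DIM('a) * conic e (p - 2) A x + ?GA \<bullet> x + ?GB \<bullet> e"
    by (simp add: sum.distrib euclidean_inner[of ?GA x] euclidean_inner[of ?GB e]
        inner_commute[of _ ?GA] inner_commute[of _ ?GB])
  \<comment> \<open>Euler's identity applies to the coefficient \<open>A\<close> of degree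
    \<open>p - 2\<close>, the axis formula to the coefficient \<open>B\<close> of degree
    \<open>p - 1\<close>.\<close>
  also have "\<dots> = (real DIM('a) + p - 2) * conic e (p - 2) A x +
      conic e (p - 2) (\<lambda>t. (1 - 2 * t) * (p - 1) * B t - 2 * t * (1 - t) * B1 t) x"
    unfolding conic_grad_inner_self[OF \<open>x \<noteq> 0\<close>] conic_grad_inner_axis[OF \<open>x \<noteq> 0\<close> e]
    by (simp add: algebra_simps)
  also have "\<dots> = conic e (p - 2) (\<lambda>t. t * (1 - t) * g2 t + (real DIM('a) - 1) / 2 * (1 - 2 * t) * g1 t +
        p * (p + real DIM('a) - 2) * g t) x"
    unfolding conic_def A_def B_def B1_def by (simp add: field_simps)
  finally show "laplacian (conic e p g) x = \<dots>" .
qed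

section \<open>Holder continuity up to the origin\<close>

lemma powr_diff_le_powr:
  fixes x y a :: real
  assumes "0 \<le> y" "y \<le> x" "0 < a" "a \<le> 1"
  shows "x powr a - y powr a \<le> (x - y) powr a"
proof (cases "x = 0")
  case False
  then have x: "0 < x"
    using assms by auto
  have *: "z \<le> z powr a" if "0 \<le> z" "z \<le> 1" for z :: real
    using powr_mono'[of a 1 z] that assms by simp
  \<comment> \<open>Both fractions lie in \<open>[0,1]\<close>, where
    \<open>z \<le> z powr a\<close>; that they sum to 1 gives subadditivity of the power.\<close>
  have "1 = y / x + (x - y) / x"
    using x by (simp add: field_simps)
  also have "\<dots> \<le> (y / x) powr a + ((x - y) / x) powr a"
    using assms x by (intro add_mono *) auto
  finally have "x powr a * 1 \<le> x powr a * ((y / x) powr a + ((x - y) / x) powr a)"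
    by (rule mult_left_mono) auto
  also have "\<dots> = y powr a + (x - y) powr a"
    using assms x by (simp add: powr_divide distrib_left)
  finally show ?thesis
    by simp
qed (use assms in auto)

lemma tilt_nonneg: "norm e = 1 \<Longrightarrow> 0 \<le> tilt e x"
  using Cauchy_Schwarz_ineq2[of x e] by (cases "x = 0") (auto simp: tilt_def divide_le_eq_1)

lemma tilt_diff_le:
  fixes x y :: "'a::real_inner"
  assumes "norm e = 1" "x \<noteq> 0" "y \<noteq> 0"
  shows "\<bar>tilt e x - tilt e y\<bar> \<le> norm (x - y) / norm x"
proof -
  have "tilt e x - tilt e y = ((sgn y - sgn x) \<bullet> e) / 2"
    by (simp add: tilt_def sgn_div_norm inner_diff_left field_simps)
  also have "\<bar>\<dots>\<bar> \<le> norm (sgn y - sgn x) / 2"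
    using Cauchy_Schwarz_ineq2[of "sgn y - sgn x" e] assms by simp
  also have "norm (sgn y - sgn x) = norm (norm x *\<^sub>R (sgn y - sgn x)) / norm x"
    using assms by simp
  \<comment> \<open>Each of the two summands has norm at most \<open>norm (x - y)\<close>; the
    resulting factor 2 is absorbed by the \<open>1 / 2\<close> in \<open>tilt\<close>.\<close>
  also have "norm x *\<^sub>R (sgn y - sgn x) = (y - x) + (norm x - norm y) *\<^sub>R sgn y"
    using assms by (simp add: sgn_div_norm algebra_simps)
  also have "norm \<dots> \<le> norm (y - x) + \<bar>norm x - norm y\<bar>"
    using norm_triangle_ineq[of "y - x" "(norm x - norm y) *\<^sub>R sgn y"] assms
    by (simp add: norm_sgn)
  also have "\<bar>norm x - norm y\<bar> \<le> norm (x - y)"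
    by (rule norm_triangle_ineq3)
  finally show ?thesis
    by (simp add: norm_minus_commute divide_right_mono)
qed

text \<open>For \<open>norm y \<le> norm x\<close> the difference splits into an angular part, where
  \<open>norm x powr a\<close> multiplies the difference of the values of \<open>g\<close>, and a
  radial part, where \<open>g (tilt e y)\<close> multiplies the difference of the powers. In the
  angular part the tilt difference, being at most 1, is replaced by its power \<open>a\<close>, so
  that \<open>norm x powr a\<close> cancels the denominator from
  \<open>tilt_diff_le\<close>.\<close>

lemma holder_continuous_on_conic:
  fixes S :: "'a::real_inner set"
  assumes e: "norm e = 1" and a: "0 < a" "a \<le> 1"
    and S: "\<And>x. x \<in> S \<Longrightarrow> x \<noteq> 0 \<Longrightarrow> tilt e x \<le> T"
    and M: "\<And>t. t \<in> {0..T} \<Longrightarrow> \<bar>g t\<bar> \<le> M"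
    and L: "\<And>s t. s \<in> {0..T} \<Longrightarrow> t \<in> {0..T} \<Longrightarrow> \<bar>g s - g t\<bar> \<le> L * \<bar>s - t\<bar>"
    and "0 \<le> L" "0 \<le> M" "T \<le> 1"
  shows "holder_continuous_on S (conic e a g)"
proof -
  have main: "\<bar>conic e a g x - conic e a g y\<bar> \<le> (L + M) * dist x y powr a"
    if "x \<in> S" "y \<in> S" and le: "norm y \<le> norm x" for x y
  \<comment> \<open>At the origin \<open>tilt\<close> is \<open>1 / 2\<close>, possibly outside
    \<open>{0..T}\<close>, so \<open>g\<close> need not be controlled there; the factor
    \<open>0 powr a = 0\<close> removes this term.\<close>
  proof (cases "y = 0")
    case True
    have "norm x powr a * \<bar>g (tilt e x)\<bar> \<le> norm x powr a * (L + M)"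
    proof (cases "x = 0")
      case False
      then have "\<bar>g (tilt e x)\<bar> \<le> L + M"
        using M[of "tilt e x"] S[OF \<open>x \<in> S\<close>] tilt_nonneg[OF e, of x] \<open>0 \<le> L\<close> by auto
      then show ?thesis
        by (intro mult_left_mono) auto
    qed auto
    then show ?thesis
      using True a by (simp add: conic_def abs_mult mult.commute)
  next
    case False
    then have x: "x \<noteq> 0"
      using le by auto
    have t: "tilt e x \<in> {0..T}" "tilt e y \<in> {0..T}"
      using S tilt_nonneg[OF e] that x False by auto
    let ?q = "\<bar>tilt e x - tilt e y\<bar>"
    have "?q \<le> 1"
      using t \<open>T \<le> 1\<close> by auto
    then have "?q \<le> ?q powr a"
      using powr_mono'[of a 1 ?q] a by simp
    also have "\<dots> \<le> (norm (x - y) / norm x) powr a"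
      using tilt_diff_le[OF e x False] a by (intro powr_mono2) auto
    also have "\<dots> = norm (x - y) powr a / norm x powr a"
      using x by (simp add: powr_divide)
    finally have q: "norm x powr a * ?q \<le> dist x y powr a"
      using x by (simp add: field_simps dist_norm)
    have "norm x powr a * \<bar>g (tilt e x) - g (tilt e y)\<bar> \<le> norm x powr a * (L * ?q)"
      using L[OF t] by (intro mult_left_mono) auto
    also have "\<dots> = L * (norm x powr a * ?q)"
      by simp
    also have "\<dots> \<le> L * dist x y powr a"
      using q \<open>0 \<le> L\<close> by (rule mult_left_mono)
    finally have 1: "norm x powr a * \<bar>g (tilt e x) - g (tilt e y)\<bar> \<le> L * dist x y powr a" .
    have "norm x powr a - norm y powr a \<le> (norm x - norm y) powr a"
      using a le by (intro powr_diff_le_powr) auto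
    also have "\<dots> \<le> dist x y powr a"
      using a le norm_triangle_ineq2[of x y] by (intro powr_mono2) (auto simp: dist_norm)
    finally have d: "norm x powr a - norm y powr a \<le> dist x y powr a" .
    have "\<bar>g (tilt e y)\<bar> * (norm x powr a - norm y powr a) \<le> M * dist x y powr a"
      using M[OF t(2)] d powr_mono2[OF _ _ le, of a] a \<open>0 \<le> M\<close> by (intro mult_mono) auto
    moreover have "conic e a g x - conic e a g y = norm x powr a * (g (tilt e x) - g (tilt e y)) +
        g (tilt e y) * (norm x powr a - norm y powr a)"
      by (simp add: conic_def algebra_simps)
    moreover have "\<bar>norm x powr a * (g (tilt e x) - g (tilt e y))\<bar> =
        norm x powr a * \<bar>g (tilt e x) - g (tilt e y)\<bar>"
      by (simp add: abs_mult)
    moreover have "\<bar>g (tilt e y) * (norm x powr a - norm y powr a)\<bar> =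
        \<bar>g (tilt e y)\<bar> * (norm x powr a - norm y powr a)"
      using le a by (simp add: abs_mult powr_mono2)
    ultimately show ?thesis
      using 1 by (simp add: distrib_right)
  qed
  have "\<bar>conic e a g x - conic e a g y\<bar> \<le> (L + M) * dist x y powr a" if "x \<in> S" "y \<in> S" for x y
  proof (cases "norm y \<le> norm x")
    case False
    then show ?thesis
      using main[OF that(2,1)] by (simp add: dist_commute[of y x] abs_minus_commute)
  qed (use main that in blast)
  then show ?thesis
    unfolding holder_continuous_on_def using a by blast
qed

text \<open>A gradient continuous up to 0 stays bounded on the axis near 0, so
  \<open>\<rho> powr (1 - p)\<close> times its axial component tends to 0. By homogeneity this
  product is the nonzero constant \<open>p * g 0\<close>.\<close>

lemma not_C1_upto_conic:
  fixes e :: "'a::euclidean_space" and g g1 :: "real \<Rightarrow> real"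
  assumes e: "norm e = 1" and p: "0 < p" "p < 1" and "0 < R"
    and \<Omega>: "\<And>\<rho>. 0 < \<rho> \<Longrightarrow> \<rho> < R \<Longrightarrow> \<rho> *\<^sub>R e \<in> \<Omega>"
    and g: "(g has_real_derivative g1 0) (at 0)" "g 0 \<noteq> 0"
  shows "\<not> C1_upto \<Omega> (insert 0 T) (conic e p g)"
proof
  assume "C1_upto \<Omega> (insert 0 T) (conic e p g)"
  then obtain G where G: "continuous_on (\<Omega> \<union> insert 0 T) G"
    and GD: "\<And>x. x \<in> \<Omega> \<Longrightarrow> GDERIV (conic e p g) x :> G x"
    by (auto simp: C1_upto_def C1_upto_with_def)
  \<comment> \<open>The shift by 2 keeps \<open>\<rho> n\<close> strictly below \<open>R\<close>
    also at \<open>n = 0\<close>.\<close>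
  define \<rho> where "\<rho> n = R / (real n + 2)" for n
  have \<rho>: "0 < \<rho> n" "\<rho> n < R" for n
    using \<open>0 < R\<close> by (auto simp: \<rho>_def divide_less_eq)
  have \<rho>0: "\<rho> \<longlonglongrightarrow> 0"
    unfolding \<rho>_def by real_asymp
  have "(\<lambda>n. G (\<rho> n *\<^sub>R e)) \<longlonglongrightarrow> G 0"
  proof (rule continuous_on_tendsto_compose[OF G])
    show "(\<lambda>n. \<rho> n *\<^sub>R e) \<longlonglongrightarrow> 0"
      using tendsto_scaleR[OF \<rho>0 tendsto_const[of e]] by simp
  qed (use \<Omega> \<rho> in auto)
  then have "(\<lambda>n. \<rho> n powr (1 - p) * (G (\<rho> n *\<^sub>R e) \<bullet> e)) \<longlonglongrightarrow> 0 * (G 0 \<bullet> e)"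
    using \<rho> p by (intro tendsto_mult tendsto_inner tendsto_const tendsto_zero_powrI[OF \<rho>0 tendsto_const]
        always_eventually) (auto intro: less_imp_le)
  moreover have "\<rho> n powr (1 - p) * (G (\<rho> n *\<^sub>R e) \<bullet> e) = p * g 0" for n
  proof -
    have "e \<bullet> e = 1"
      using e by (simp add: dot_square_norm)
    have "\<rho> n *\<^sub>R e \<noteq> 0"
      using \<rho>[of n] e by auto
    have t: "tilt e (\<rho> n *\<^sub>R e) = 0"
      using \<rho>[of n] e \<open>e \<bullet> e = 1\<close> by (simp add: tilt_def)
    have "GDERIV (conic e p g) (\<rho> n *\<^sub>R e) :> conic_grad e p g g1 (\<rho> n *\<^sub>R e)"
      using g t by (intro GDERIV_conic \<open>\<rho> n *\<^sub>R e \<noteq> 0\<close>) auto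
    from grad_eq[OF this] grad_eq[OF GD[OF \<Omega>[OF \<rho>]]]
    have "G (\<rho> n *\<^sub>R e) \<bullet> e = conic_grad e p g g1 (\<rho> n *\<^sub>R e) \<bullet> e"
      by simp
    also have "\<dots> = \<rho> n powr (p - 1) * (p * g 0)"
      using \<rho>[of n] e by (simp add: conic_grad_inner_axis \<open>\<rho> n *\<^sub>R e \<noteq> 0\<close> conic_def t del: scaleR_eq_0_iff)
    finally show ?thesis
      using \<rho>[of n] by (simp flip: powr_add mult.assoc)
  qed
  ultimately have "p * g 0 = 0"
    by (simp add: tendsto_const_iff)
  then show False
    using p g by simp
qed

subsection \<open>Hypergeometric profiles\<close>

text \<open>The solution of the hypergeometric equation that is regular at \<open>t = 0\<close>,
  \<open>F(-a, a + m - 1; m / 2; t)\<close>, is written \<open>1 - a * t * (\<Sum>k. hyp_coeff m a k * t ^ k)\<close>. Splitting off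
  the factor \<open>a\<close> removes the trivial zero \<open>a = 0\<close> of the boundary condition.\<close>

fun hyp_coeff :: "real \<Rightarrow> real \<Rightarrow> nat \<Rightarrow> real" where
  "hyp_coeff m a 0 = 2 * (a + m - 1) / m"
| "hyp_coeff m a (Suc k) =
     hyp_coeff m a k * ((real k + 1 - a) * (real k + a + m)) / ((real k + 2) * (real k + 1 + m / 2))"

text \<open>A majorant free of \<open>a\<close>, so that convergence is uniform in \<open>a\<close>.
  Its successive ratios tend to 1, which preserves the radius of convergence 1.\<close>

fun hyp_bound :: "real \<Rightarrow> nat \<Rightarrow> real" where
  "hyp_bound m 0 = 2"
| "hyp_bound m (Suc k) = hyp_bound m k * ((real k + 1 + m) / (real k + 2))"

lemma hyp_coeff_bounds:
  assumes "m \<ge> 1" "0 \<le> a" "a \<le> 1"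
  shows "0 \<le> hyp_coeff m a k \<and> hyp_coeff m a k \<le> hyp_bound m k"
proof (induction k)
  case 0
  then show ?case
    using assms by (simp add: field_simps)
next
  case (Suc k)
  have "0 \<le> (real k + 1 - a) * (real k + a + m) / ((real k + 2) * (real k + 1 + m / 2))"
    using assms by (auto intro!: divide_nonneg_nonneg mult_nonneg_nonneg)
  \<comment> \<open>Enlarging the first factor to \<open>real k + 1 + m / 2\<close> cancels it
    against the denominator and leaves exactly the ratio of \<open>hyp_bound\<close>.\<close>
  moreover have "(real k + 1 - a) * (real k + a + m) \<le> (real k + 1 + m / 2) * (real k + 1 + m)"
    using assms by (intro mult_mono) auto
  then have "(real k + 1 - a) * (real k + a + m) / ((real k + 2) * (real k + 1 + m / 2)) \<le>
      (real k + 1 + m / 2) * (real k + 1 + m) / ((real k + 2) * (real k + 1 + m / 2))"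
    using assms by (intro divide_right_mono) auto
  moreover have "\<dots> = (real k + 1 + m) / (real k + 2)"
    using assms by simp
  moreover have "hyp_coeff m a (Suc k) =
      hyp_coeff m a k * ((real k + 1 - a) * (real k + a + m) / ((real k + 2) * (real k + 1 + m / 2)))"
    by (simp only: hyp_coeff.simps times_divide_eq_right)
  ultimately show ?case
    using Suc unfolding hyp_bound.simps by (auto simp only: intro!: mult_mono mult_nonneg_nonneg)
qed

text \<open>The weight \<open>real (Suc k)\<close> lets a single majorant serve both
  \<open>hyp_sum\<close> and \<open>hyp_dsum\<close>.\<close>

lemma summable_hyp_bound:
  assumes "m \<ge> 1" "\<bar>t\<bar> < 1"
  shows "summable (\<lambda>k. real (Suc k) * hyp_bound m k * t ^ k)"
proof -
  define c where "c = (1 + \<bar>t\<bar>) / 2"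
  have "((\<lambda>k. (real k + 1 + m) / (real k + 1) * \<bar>t\<bar>) \<longlongrightarrow> 1 * \<bar>t\<bar>) sequentially"
    by (intro tendsto_mult tendsto_const) real_asymp
  moreover have "\<bar>t\<bar> < c" "c < 1"
    using assms by (auto simp: c_def)
  ultimately have "\<forall>\<^sub>F k in sequentially. (real k + 1 + m) / (real k + 1) * \<bar>t\<bar> < c"
    by (intro order_tendstoD) auto
  then obtain N where N: "\<And>k. k \<ge> N \<Longrightarrow> (real k + 1 + m) / (real k + 1) * \<bar>t\<bar> < c"
    by (auto simp: eventually_sequentially)
  show ?thesis
  proof (rule summable_ratio_test[OF \<open>c < 1\<close>, of N])
    fix k assume "k \<ge> N"
    have "real (Suc (Suc k)) * hyp_bound m (Suc k) =
        (real k + 1 + m) / (real k + 1) * (real (Suc k) * hyp_bound m k)"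
      by (simp add: divide_simps) (simp add: algebra_simps)
    then have "norm (real (Suc (Suc k)) * hyp_bound m (Suc k) * t ^ Suc k) =
        norm ((real k + 1 + m) / (real k + 1) * t * (real (Suc k) * hyp_bound m k * t ^ k))"
      by (simp only: power_Suc mult_ac)
    also have "\<dots> = ((real k + 1 + m) / (real k + 1) * \<bar>t\<bar>) * norm (real (Suc k) * hyp_bound m k * t ^ k)"
      using assms(1) by (simp only: norm_mult) simp
    also have "\<dots> \<le> c * norm (real (Suc k) * hyp_bound m k * t ^ k)"
      using N[OF \<open>k \<ge> N\<close>] by (intro mult_right_mono) auto
    finally show "norm (real (Suc (Suc k)) * hyp_bound m (Suc k) * t ^ Suc k)
        \<le> c * norm (real (Suc k) * hyp_bound m k * t ^ k)" .
  qed
qed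

lemma hyp_coeff_le_bound:
  assumes "m \<ge> 1" "0 \<le> a" "a \<le> 1"
  shows "norm (hyp_coeff m a k * t ^ k) \<le> real (Suc k) * hyp_bound m k * \<bar>t\<bar> ^ k"
    and "norm (real (Suc k) * hyp_coeff m a k * t ^ k) \<le> real (Suc k) * hyp_bound m k * \<bar>t\<bar> ^ k"
proof -
  have *: "0 \<le> hyp_coeff m a k" "hyp_coeff m a k \<le> hyp_bound m k"
    using hyp_coeff_bounds[OF assms] by auto
  then show 1: "norm (real (Suc k) * hyp_coeff m a k * t ^ k) \<le> real (Suc k) * hyp_bound m k * \<bar>t\<bar> ^ k"
    by (simp add: abs_mult power_abs mult_left_mono mult_right_mono)
  have "norm (hyp_coeff m a k * t ^ k) \<le> norm (real (Suc k) * hyp_coeff m a k * t ^ k)"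
    using mult_left_mono[of 1 "real (Suc k)" "norm (hyp_coeff m a k * t ^ k)"]
    by (simp add: norm_mult mult_ac del: of_nat_Suc)
  with 1 show "norm (hyp_coeff m a k * t ^ k) \<le> real (Suc k) * hyp_bound m k * \<bar>t\<bar> ^ k"
    by linarith
qed

lemma summable_hyp_coeff:
  assumes "m \<ge> 1" "0 \<le> a" "a \<le> 1" "\<bar>t\<bar> < 1"
  shows "summable (\<lambda>k. hyp_coeff m a k * t ^ k)"
    and "summable (\<lambda>k. real (Suc k) * hyp_coeff m a k * t ^ k)"
  using summable_hyp_bound[of m "\<bar>t\<bar>"] hyp_coeff_le_bound[OF assms(1-3)] assms
  by (auto intro: summable_comparison_test')

text \<open>The exponent \<open>a\<close> comes last because the sums are used as functions of
  \<open>a\<close> at a fixed \<open>t\<close>.\<close>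

definition hyp_sum :: "real \<Rightarrow> real \<Rightarrow> real \<Rightarrow> real" where
  "hyp_sum m t a = (\<Sum>k. hyp_coeff m a k * t ^ k)"

text \<open>The \<open>t\<close>-derivative of \<open>t * hyp_sum m t a\<close>; the profile
  therefore has slope \<open>- a * hyp_dsum m t a\<close>.\<close>

definition hyp_dsum :: "real \<Rightarrow> real \<Rightarrow> real \<Rightarrow> real" where
  "hyp_dsum m t a = (\<Sum>k. real (Suc k) * hyp_coeff m a k * t ^ k)"

lemma continuous_hyp_coeff:
  assumes "m \<ge> 1"
  shows "continuous_on S (\<lambda>a. hyp_coeff m a k)"
proof (induction k)
  case 0
  then show ?case
    using assms by (auto intro!: continuous_intros)
next
  case (Suc k)
  have "(real k + 2) * (real k + 1 + m / 2) \<noteq> 0"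
    using assms by auto
  with Suc show ?case
    by (auto intro!: continuous_intros)
qed

lemma
  assumes "m \<ge> 1" "\<bar>t\<bar> < 1"
  shows continuous_hyp_sum: "continuous_on {0..1} (hyp_sum m t)"
    and continuous_hyp_dsum: "continuous_on {0..1} (hyp_dsum m t)"
proof -
  have sm: "summable (\<lambda>k. real (Suc k) * hyp_bound m k * \<bar>t\<bar> ^ k)"
    using assms by (intro summable_hyp_bound) auto
  show "continuous_on {0..1} (hyp_sum m t)"
    unfolding hyp_sum_def
    by (rule uniform_limit_theorem[OF _ Weierstrass_m_test[OF hyp_coeff_le_bound(1)[OF assms(1)] sm]])
      (auto intro!: always_eventually continuous_intros continuous_hyp_coeff assms)
  show "continuous_on {0..1} (hyp_dsum m t)"
    unfolding hyp_dsum_def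
    by (rule uniform_limit_theorem[OF _ Weierstrass_m_test[OF hyp_coeff_le_bound(2)[OF assms(1)] sm]])
      (auto intro!: always_eventually continuous_intros continuous_hyp_coeff assms)
qed

section \<open>The endpoint values \<open>a = 1\<close> and \<open>a = 0\<close>\<close>

lemma hyp_coeff_1:
  assumes "m \<ge> 1"
  shows "hyp_coeff m 1 k = (if k = 0 then 2 else 0)"
  \<comment> \<open>At \<open>k = 0\<close> the factor \<open>real k + 1 - a\<close> of the
    recursion vanishes, which kills all later coefficients.\<close>
  using assms by (induction k) auto

lemma
  assumes "m \<ge> 1"
  shows hyp_sum_1: "hyp_sum m t 1 = 2" and hyp_dsum_1: "hyp_dsum m t 1 = 2"
proof -
  have "(\<Sum>k. hyp_coeff m 1 k * t ^ k) = (\<Sum>k\<in>{0}. hyp_coeff m 1 k * t ^ k)"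
    by (rule suminf_finite) (auto simp: hyp_coeff_1[OF assms])
  then show "hyp_sum m t 1 = 2"
    unfolding hyp_sum_def using assms by simp
  have "(\<Sum>k. real (Suc k) * hyp_coeff m 1 k * t ^ k) = (\<Sum>k\<in>{0}. real (Suc k) * hyp_coeff m 1 k * t ^ k)"
    by (rule suminf_finite) (auto simp: hyp_coeff_1[OF assms])
  then show "hyp_dsum m t 1 = 2"
    unfolding hyp_dsum_def using assms by simp
qed

lemma hyp_dsum_nonneg:
  assumes "m \<ge> 1" "0 \<le> a" "a \<le> 1" "0 \<le> t" "t < 1"
  shows "0 \<le> hyp_dsum m t a"
  unfolding hyp_dsum_def
  using assms hyp_coeff_bounds[OF assms(1-3)] by (intro suminf_nonneg summable_hyp_coeff) auto

text \<open>At \<open>a = 0\<close> the weighted coefficients have successive ratios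
  \<open>(real k + m) / (real k + 1 + m / 2)\<close>, which are at most 2. This prepares the
  comparison of \<open>hyp_dsum\<close> with a geometric series in \<open>2 * t\<close>.\<close>

lemma hyp_coeff_0_le:
  assumes "m \<ge> 1"
  shows "real (Suc k) * hyp_coeff m 0 k \<le> 2 * 2 ^ k"
proof (induction k)
  case 0
  then show ?case
    using assms by (simp add: field_simps)
next
  case (Suc k)
  have nn: "0 \<le> hyp_coeff m 0 k"
    using hyp_coeff_bounds[OF assms, of 0 k] by simp
  have "real (Suc (Suc k)) * hyp_coeff m 0 (Suc k) =
      real (Suc k) * hyp_coeff m 0 k * ((real k + m) / (real k + 1 + m / 2))"
    using assms by (simp add: divide_simps) (simp add: algebra_simps)
  also have "\<dots> \<le> real (Suc k) * hyp_coeff m 0 k * 2"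
    using assms nn by (intro mult_left_mono) (auto simp: field_simps)
  also have "\<dots> \<le> 2 * 2 ^ Suc k"
    using Suc by (simp add: mult.commute)
  finally show ?case .
qed

text \<open>For \<open>t = (1 - cos \<theta>\<^sub>0) / 2\<close> this is the inequality \<open>K < tan \<theta>\<^sub>0\<close>.\<close>

lemma hyp_dsum_0_less:
  assumes "m \<ge> 1" "0 \<le> t" "t < 1 / 2"
  shows "hyp_dsum m t 0 * (1 - 2 * t) < 2"
proof -
  have g: "(\<lambda>k. 2 * (2 * t) ^ k) sums (2 * (1 / (1 - 2 * t)))"
    using assms by (intro sums_mult geometric_sums) auto
  have h: "(\<lambda>k. real (Suc k) * hyp_coeff m 0 k * t ^ k) sums hyp_dsum m t 0"
    unfolding hyp_dsum_def using assms by (intro summable_sums summable_hyp_coeff) auto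
  let ?d = "\<lambda>k. 2 * (2 * t) ^ k - real (Suc k) * hyp_coeff m 0 k * t ^ k"
  have d: "?d sums (2 * (1 / (1 - 2 * t)) - hyp_dsum m t 0)"
    by (rule sums_diff[OF g h])
  have nn: "0 \<le> ?d k" for k
    using mult_right_mono[OF hyp_coeff_0_le[OF assms(1), of k], of "t ^ k"] assms
    by (simp add: power_mult_distrib mult.assoc)
  \<comment> \<open>The constant terms differ by \<open>2 / m\<close>; this is where the strict
    inequality comes from.\<close>
  have "0 < ?d 0"
    using assms by (simp add: field_simps)
  then have "0 < suminf ?d"
    using nn by (intro suminf_pos2[OF sums_summable[OF d], of 0]) auto
  also have "suminf ?d = 2 * (1 / (1 - 2 * t)) - hyp_dsum m t 0"
    using d by (simp add: sums_iff)
  finally show ?thesis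
    using assms by (simp add: field_simps)
qed

section \<open>The profile and its differential equation\<close>

definition hyp_taylor :: "real \<Rightarrow> real \<Rightarrow> nat \<Rightarrow> real" where
  "hyp_taylor m a k = (case k of 0 \<Rightarrow> 1 | Suc j \<Rightarrow> - a * hyp_coeff m a j)"

text \<open>The \<open>j\<close>-th derivative of the profile. Indexing by \<open>j\<close> lets one
  differentiation rule supply the profile and both derivatives in the equation.\<close>

definition hyp_deriv :: "real \<Rightarrow> real \<Rightarrow> nat \<Rightarrow> real \<Rightarrow> real" where
  "hyp_deriv m a j t = (\<Sum>k. (diffs ^^ j) (hyp_taylor m a) k * t ^ k)"

lemma summable_hyp_taylor:
  assumes "m \<ge> 1" "0 \<le> a" "a \<le> 1" "\<bar>t\<bar> < 1"
  shows "summable (\<lambda>k. (diffs ^^ j) (hyp_taylor m a) k * t ^ k)"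
  using assms(4)
proof (induction j arbitrary: t)
  case 0
  have "summable (\<lambda>k. (- a * t) * (hyp_coeff m a k * t ^ k))"
    using 0 assms by (intro summable_mult summable_hyp_coeff)
  then have "summable (\<lambda>k. hyp_taylor m a (Suc k) * t ^ Suc k)"
    by (simp add: hyp_taylor_def mult_ac)
  then show ?case
    using summable_Suc_iff[of "\<lambda>k. hyp_taylor m a k * t ^ k"] by simp
next
  case (Suc j)
  then show ?case
    using termdiff_converges[of t 1 "(diffs ^^ j) (hyp_taylor m a)"] by auto
qed

lemma has_derivative_hyp_deriv:
  assumes "m \<ge> 1" "0 \<le> a" "a \<le> 1" "\<bar>t\<bar> < 1"
  shows "(hyp_deriv m a j has_real_derivative hyp_deriv m a (Suc j) t) (at t)"
  unfolding hyp_deriv_def funpow.simps comp_def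
  using assms by (intro termdiffs_strong'[where K = 1] summable_hyp_taylor) auto

lemma hyp_deriv_eq:
  assumes "m \<ge> 1" "0 \<le> a" "a \<le> 1" "\<bar>t\<bar> < 1"
  shows "hyp_deriv m a 0 t = 1 - a * t * hyp_sum m t a"
    and "hyp_deriv m a (Suc 0) t = - a * hyp_dsum m t a"
proof -
  have "hyp_deriv m a 0 t = 1 + (\<Sum>k. hyp_taylor m a (Suc k) * t ^ Suc k)"
    using suminf_split_head[OF summable_hyp_taylor[OF assms, of 0]]
    by (simp add: hyp_deriv_def hyp_taylor_def)
  also have "(\<Sum>k. hyp_taylor m a (Suc k) * t ^ Suc k) = (\<Sum>k. (- a * t) * (hyp_coeff m a k * t ^ k))"
    by (simp add: hyp_taylor_def mult_ac)
  also have "\<dots> = (- a * t) * hyp_sum m t a"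
    unfolding hyp_sum_def using assms by (intro suminf_mult summable_hyp_coeff)
  finally show "hyp_deriv m a 0 t = 1 - a * t * hyp_sum m t a"
    by simp
  have "hyp_deriv m a (Suc 0) t = (\<Sum>k. - a * (real (Suc k) * hyp_coeff m a k * t ^ k))"
    unfolding hyp_deriv_def by (simp add: diffs_def hyp_taylor_def mult_ac)
  also have "\<dots> = - a * hyp_dsum m t a"
    unfolding hyp_dsum_def using assms by (intro suminf_mult summable_hyp_coeff)
  finally show "hyp_deriv m a (Suc 0) t = - a * hyp_dsum m t a" .
qed

text \<open>The standard hypergeometric recurrence, recovered from the shifted coefficients: at
  \<open>k = 0\<close> the factor \<open>real k - a\<close> is the \<open>- a\<close> that was split
  off from \<open>hyp_coeff\<close>.\<close>

lemma hyp_taylor_Suc: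
  assumes "m \<ge> 1"
  shows "hyp_taylor m a (Suc k) * ((real k + 1) * (real k + m / 2)) = hyp_taylor m a k * ((real k - a) * (real k + a + m - 1))"
proof (cases k)
  case 0
  then show ?thesis
    using assms by (simp add: hyp_taylor_def)
next
  case (Suc j)
  have nz: "(real j + 2) * (real j + 1 + m / 2) \<noteq> 0"
    using assms by auto
  have "hyp_coeff m a (Suc j) * ((real j + 2) * (real j + 1 + m / 2)) = hyp_coeff m a j * ((real j + 1 - a) * (real j + a + m))"
    by (simp only: hyp_coeff.simps times_divide_eq_left nonzero_mult_div_cancel_right[OF nz])
  then have "- a * (hyp_coeff m a (Suc j) * ((real j + 2) * (real j + 1 + m / 2))) =
      - a * (hyp_coeff m a j * ((real j + 1 - a) * (real j + a + m)))"
    by (rule arg_cong)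
  then show ?thesis
    unfolding Suc by (simp add: hyp_taylor_def add_ac mult_ac del: hyp_coeff.simps)
qed

text \<open>Multiplication by \<open>t\<close> shifts coefficients. The shifted sequence
  \<open>h\<close> is a parameter so that it can be supplied in closed form; the forms used later
  carry a factor \<open>real k\<close>, hence vanish at 0.\<close>

lemma powser_shift_sums:
  fixes t :: real
  assumes "(\<lambda>k. f k * t ^ k) sums S" "h 0 = 0" "\<And>k. h (Suc k) = f k"
  shows "(\<lambda>k. h k * t ^ k) sums (t * S)"
proof -
  have "(\<lambda>k. h (Suc k) * t ^ Suc k) sums (t * S)"
    using sums_mult[OF assms(1), of t] by (simp add: assms mult_ac)
  then show ?thesis
    using sums_Suc_iff[of "\<lambda>k. h k * t ^ k" "t * S"] assms(2) by simp
qed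

lemma hyp_deriv_ode:
  assumes "m \<ge> 1" "0 \<le> a" "a \<le> 1" "\<bar>t\<bar> < 1"
  shows "t * (1 - t) * hyp_deriv m a (Suc (Suc 0)) t + m / 2 * (1 - 2 * t) * hyp_deriv m a (Suc 0) t +
    a * (a + m - 1) * hyp_deriv m a 0 t = 0"
proof -
  let ?c = "hyp_taylor m a"
  have s: "(\<lambda>k. (diffs ^^ j) ?c k * t ^ k) sums hyp_deriv m a j t" for j
    unfolding hyp_deriv_def using assms by (intro summable_sums summable_hyp_taylor)
  have s0: "(\<lambda>k. ?c k * t ^ k) sums hyp_deriv m a 0 t"
    using s[of 0] by simp
  have s1: "(\<lambda>k. real (Suc k) * ?c (Suc k) * t ^ k) sums hyp_deriv m a (Suc 0) t"
    using s[of "Suc 0"] by (simp add: diffs_def)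
  have s2: "(\<lambda>k. (real (Suc k) * real (Suc (Suc k)) * ?c (Suc (Suc k))) * t ^ k)
      sums hyp_deriv m a (Suc (Suc 0)) t"
    using s[of "Suc (Suc 0)"] by (simp add: diffs_def mult.assoc)
  have t1: "(\<lambda>k. (real k * ?c k) * t ^ k) sums (t * hyp_deriv m a (Suc 0) t)"
    by (rule powser_shift_sums[OF s1]) auto
  have t2: "(\<lambda>k. (real k * real (Suc k) * ?c (Suc k)) * t ^ k) sums (t * hyp_deriv m a (Suc (Suc 0)) t)"
    by (rule powser_shift_sums[OF s2]) auto
  have tt2: "(\<lambda>k. ((real k - 1) * real k * ?c k) * t ^ k) sums (t * (t * hyp_deriv m a (Suc (Suc 0)) t))"
    by (rule powser_shift_sums[OF t2]) auto
  \<comment> \<open>The \<open>t ^ k\<close> terms of the equation with \<open>t * (1 - t)\<close>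
    and \<open>1 - 2 * t\<close> multiplied out; they cancel by the recurrence.\<close>
  let ?f = "\<lambda>k. (real k * real (Suc k) * ?c (Suc k)) * t ^ k - ((real k - 1) * real k * ?c k) * t ^ k +
    m / 2 * (real (Suc k) * ?c (Suc k) * t ^ k) - m * ((real k * ?c k) * t ^ k) +
    a * (a + m - 1) * (?c k * t ^ k)"
  have "?f sums (t * hyp_deriv m a (Suc (Suc 0)) t - t * (t * hyp_deriv m a (Suc (Suc 0)) t) +
      m / 2 * hyp_deriv m a (Suc 0) t - m * (t * hyp_deriv m a (Suc 0) t) +
      a * (a + m - 1) * hyp_deriv m a 0 t)"
    by (intro sums_add sums_diff sums_mult s0 s1 t1 t2 tt2)
  moreover have "?f k = 0" for k
  proof -
    have "?f k = (?c (Suc k) * ((real k + 1) * (real k + m / 2)) - ?c k * ((real k - a) * (real k + a + m - 1))) * t ^ k"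
      by (simp add: algebra_simps)
    also have "\<dots> = 0"
      by (simp only: hyp_taylor_Suc[OF assms(1)] diff_self mult_zero_left)
    finally show ?thesis .
  qed
  ultimately have "t * hyp_deriv m a (Suc (Suc 0)) t - t * (t * hyp_deriv m a (Suc (Suc 0)) t) +
      m / 2 * hyp_deriv m a (Suc 0) t - m * (t * hyp_deriv m a (Suc 0) t) +
      a * (a + m - 1) * hyp_deriv m a 0 t = 0"
    by (simp add: sums_iff)
  then show ?thesis
    by (simp add: algebra_simps)
qed

subsection \<open>The cone\<close>

lemma
  shows cos_polar_angle: "cos (polar_angle x) = snd x / norm x"
    and polar_angle_bounds: "0 \<le> polar_angle x" "polar_angle x \<le> pi"
proof -
  have "\<bar>snd x\<bar> \<le> norm x"
    using norm_snd_le[of "snd x" "fst x"] by simp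
  then have "\<bar>snd x / norm x\<bar> \<le> 1"
    by (simp add: divide_le_eq_1)
  then have "- 1 \<le> snd x / norm x" "snd x / norm x \<le> 1"
    unfolding abs_le_iff by linarith+
  then show "cos (polar_angle x) = snd x / norm x" "0 \<le> polar_angle x" "polar_angle x \<le> pi"
    unfolding polar_angle_def by (auto intro!: arccos_lbound arccos_ubound cos_arccos)
qed

lemma tilt_polar_angle: "tilt (0, 1) x = (1 - cos (polar_angle x)) / 2"
  by (simp add: cos_polar_angle tilt_def inner_prod_def)

text \<open>Monotonicity of cosine on \<open>[0, pi]\<close> turns the angle condition into an
  inequality between continuous functions, from which openness and the bound on the closure
  follow.\<close>

lemma cone_domain_eq:
  assumes "0 < \<theta>\<^sub>0" "\<theta>\<^sub>0 < pi"
  shows "cone_domain R \<theta>\<^sub>0 = {x. 0 < norm x \<and> norm x < R \<and> norm x * cos \<theta>\<^sub>0 < snd x}"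
proof -
  have "polar_angle x < \<theta>\<^sub>0 \<longleftrightarrow> norm x * cos \<theta>\<^sub>0 < snd x" if "0 < norm x" for x :: "(real^'a) \<times> real"
    using cos_mono_less_eq[of \<theta>\<^sub>0 "polar_angle x"] polar_angle_bounds[of x] assms that
    by (simp add: cos_polar_angle field_simps)
  then show ?thesis
    unfolding cone_domain_def using polar_angle_bounds by auto
qed

lemma open_cone_domain: "0 < \<theta>\<^sub>0 \<Longrightarrow> \<theta>\<^sub>0 < pi \<Longrightarrow> open (cone_domain R \<theta>\<^sub>0)"
  by (simp only: cone_domain_eq) (intro open_Collect_conj open_Collect_less continuous_intros)

lemma closure_cone_domain:
  assumes "0 < \<theta>\<^sub>0" "\<theta>\<^sub>0 < pi" "x \<in> closure (cone_domain R \<theta>\<^sub>0)" "x \<noteq> 0"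
  shows "tilt (0, 1) x \<le> (1 - cos \<theta>\<^sub>0) / 2"
proof -
  have "closure (cone_domain R \<theta>\<^sub>0) \<subseteq> {x. norm x * cos \<theta>\<^sub>0 \<le> snd x}"
    using assms by (intro closure_minimal closed_Collect_le continuous_intros) (auto simp: cone_domain_eq)
  with assms show ?thesis
    by (auto simp: tilt_def inner_prod_def field_simps)
qed

lemma beta_inner_conic_grad:
  fixes x :: "(real^'m::finite) \<times> real"
  assumes "x \<in> cone_boundary R \<theta>\<^sub>0" "0 < \<theta>\<^sub>0" "\<theta>\<^sub>0 < pi"
  shows "beta s x \<bullet> conic_grad (0, 1) p g g' x = norm x powr (p - 1) *
    (p * cos (\<theta>\<^sub>0 - s) * g ((1 - cos \<theta>\<^sub>0) / 2) - sin (\<theta>\<^sub>0 - s) * sin \<theta>\<^sub>0 / 2 * g' ((1 - cos \<theta>\<^sub>0) / 2))"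
proof -
  have x: "x \<noteq> 0" and th: "polar_angle x = \<theta>\<^sub>0"
    using assms by (auto simp: cone_boundary_def)
  have t: "tilt (0, 1) x = (1 - cos \<theta>\<^sub>0) / 2"
    by (simp add: tilt_polar_angle th)
  have snd: "snd x = norm x * cos \<theta>\<^sub>0"
    using cos_polar_angle[of x] x th by simp
  have "(norm (fst x))\<^sup>2 = (norm x)\<^sup>2 - (snd x)\<^sup>2"
    by (simp add: norm_prod_def)
  also have "\<dots> = (norm x * sin \<theta>\<^sub>0)\<^sup>2"
    unfolding snd power_mult_distrib sin_squared_eq by (simp add: right_diff_distrib)
  finally have fst: "norm (fst x) = norm x * sin \<theta>\<^sub>0"
    by (rule power2_eq_imp_eq) (use assms sin_gt_zero[of \<theta>\<^sub>0] in auto)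
  have "sgn (fst x) \<bullet> fst x = norm (fst x)"
    by (cases "fst x = 0") (simp_all add: sgn_div_norm dot_square_norm power2_eq_square)
  then have "beta s x \<bullet> x = sin s * norm (fst x) + cos s * snd x"
    by (simp add: beta_def inner_prod_def)
  then have bx: "beta s x \<bullet> x = norm x * cos (\<theta>\<^sub>0 - s)"
    unfolding snd fst cos_diff by (simp add: algebra_simps)
  \<comment> \<open>Writing \<open>s\<close> as
    \<open>\<theta>\<^sub>0 - (\<theta>\<^sub>0 - s)\<close> makes the \<open>g'\<close> terms with
    \<open>cos \<theta>\<^sub>0 * cos (\<theta>\<^sub>0 - s)\<close> cancel against those from the
    radial component.\<close>
  have be: "beta s x \<bullet> (0, 1) = cos \<theta>\<^sub>0 * cos (\<theta>\<^sub>0 - s) + sin \<theta>\<^sub>0 * sin (\<theta>\<^sub>0 - s)"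
    unfolding cos_diff[symmetric] by (simp add: beta_def inner_prod_def)
  have p: "norm x powr (p - 1) = norm x powr p / norm x"
    "norm x powr (p - 2) = norm x powr p / (norm x)\<^sup>2"
    using x by (simp_all add: powr_diff)
  define T where "T = (1 - cos \<theta>\<^sub>0) / 2"
  have cos: "cos \<theta>\<^sub>0 = 1 - 2 * T"
    by (simp add: T_def field_simps)
  show ?thesis
    unfolding conic_grad_def conic_def inner_add_right inner_scaleR_right bx be t p T_def[symmetric]
    using x unfolding cos by (simp add: field_simps power2_eq_square)
qed

section \<open>The solution attached to a root of the boundary equation\<close>

lemma norm_axis [simp]: "norm (0 :: real^'m::finite, 1 :: real) = 1"
  by (simp add: norm_prod_def)

text \<open>Here \<open>m\<close> is \<open>n - 1\<close>, which matches the Laplacian with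
  \<open>hyp_deriv_ode\<close>. The hypothesis \<open>zero\<close> is the oblique condition freed of
  the factor \<open>a\<close> and of the power of \<open>norm x\<close>.\<close>

lemma singular_axisymmetric_solution_conic:
  fixes s :: real
  assumes th: "0 < \<theta>\<^sub>0" "\<theta>\<^sub>0 < pi" and a: "0 < a" "a < 1" and "0 < R"
  defines "m \<equiv> real CARD('m::finite)" and "T \<equiv> (1 - cos \<theta>\<^sub>0) / 2"
  assumes zero: "cos (\<theta>\<^sub>0 - s) * (1 - a * T * hyp_sum m T a) +
    sin (\<theta>\<^sub>0 - s) * sin \<theta>\<^sub>0 / 2 * hyp_dsum m T a = 0"
  shows "singular_axisymmetric_solution R \<theta>\<^sub>0 s
    (conic (0, 1) a (hyp_deriv m a 0) :: (real^'m) \<times> real \<Rightarrow> real)"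
proof -
  define e :: "(real^'m) \<times> real" where "e = (0, 1)"
  have e: "norm e = 1"
    by (simp add: e_def)
  let ?\<Omega> = "cone_domain R \<theta>\<^sub>0 :: ((real^'m) \<times> real) set"
    and ?\<Gamma> = "cone_boundary R \<theta>\<^sub>0 :: ((real^'m) \<times> real) set"
    and ?\<phi> = "hyp_deriv m a"
  let ?u = "conic e a (?\<phi> 0)"
  have m: "m \<ge> 1"
    unfolding m_def by (simp add: Suc_leI)
  have "-1 < cos \<theta>\<^sub>0" "cos \<theta>\<^sub>0 < 1"
    using cos_monotone_0_pi[of \<theta>\<^sub>0 pi] cos_monotone_0_pi[of 0 \<theta>\<^sub>0] th by auto
  then have T: "0 < T" "T < 1"
    by (auto simp: T_def)
  have deriv: "(?\<phi> j has_real_derivative ?\<phi> (Suc j) t) (at t)" if "0 \<le> t" "t \<le> T" for j t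
    using that T a m by (intro has_derivative_hyp_deriv) auto
  then have cont: "isCont (?\<phi> j) t" if "0 \<le> t" "t \<le> T" for j t
    using that by (blast intro: DERIV_isCont)
  have tilt: "0 \<le> tilt e x" "x \<in> ?\<Omega> \<union> ?\<Gamma> \<Longrightarrow> tilt e x \<le> T" for x
  proof -
    show "0 \<le> tilt e x"
      by (rule tilt_nonneg[OF e])
    assume "x \<in> ?\<Omega> \<union> ?\<Gamma>"
    then have "0 \<le> polar_angle x" "polar_angle x \<le> \<theta>\<^sub>0"
      using polar_angle_bounds[of x] by (auto simp: cone_domain_def cone_boundary_def)
    then have "cos \<theta>\<^sub>0 \<le> cos (polar_angle x)"
      using th by (intro cos_monotone_0_pi_le) auto
    then show "tilt e x \<le> T"
      by (simp add: e_def T_def tilt_polar_angle)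
  qed
  have nz: "0 \<notin> ?\<Omega> \<union> ?\<Gamma>"
    by (auto simp: cone_domain_def cone_boundary_def)
  have grad: "GDERIV ?u x :> conic_grad e a (?\<phi> 0) (?\<phi> (Suc 0)) x" if "x \<in> ?\<Omega>" for x
    using that tilt[of x] nz by (intro GDERIV_conic deriv) auto
  have "C2_on ?\<Omega> ?u"
    using tilt nz open_cone_domain[OF th]
    by (intro C2_on_conic[where ?g1.0 = "?\<phi> (Suc 0)" and ?g2.0 = "?\<phi> (Suc (Suc 0))"] e deriv cont) auto
  moreover have "laplacian ?u x = 0" if x: "x \<in> ?\<Omega>" for x
  proof -
    have "laplacian ?u x = conic e (a - 2) (\<lambda>t. t * (1 - t) * ?\<phi> (Suc (Suc 0)) t +
        (real DIM((real^'m) \<times> real) - 1) / 2 * (1 - 2 * t) * ?\<phi> (Suc 0) t +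
        a * (a + real DIM((real^'m) \<times> real) - 2) * ?\<phi> 0 t) x"
      using tilt nz open_cone_domain[OF th] x by (intro laplacian_conic[where \<Omega> = ?\<Omega>] e deriv cont) auto
    moreover have "(real DIM((real^'m) \<times> real) - 1) / 2 = m / 2"
      "a + real DIM((real^'m) \<times> real) - 2 = a + m - 1"
      by (simp_all add: m_def)
    moreover have "t * (1 - t) * ?\<phi> (Suc (Suc 0)) t + m / 2 * (1 - 2 * t) * ?\<phi> (Suc 0) t +
        a * (a + m - 1) * ?\<phi> 0 t = 0" if "t = tilt e x" for t
      using that tilt[of x] x T a m by (intro hyp_deriv_ode) auto
    ultimately show ?thesis
      unfolding conic_def by simp
  qed
  moreover have "C1_upto_with ?\<Omega> ?\<Gamma> ?u (conic_grad e a (?\<phi> 0) (?\<phi> (Suc 0)))"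
    unfolding C1_upto_with_def using tilt
    by (intro conjI ballI grad continuous_on_conic continuous_on_conic_grad nz cont) auto
  moreover have "beta s x \<bullet> conic_grad e a (?\<phi> 0) (?\<phi> (Suc 0)) x = 0" if "x \<in> ?\<Gamma>" for x
  proof -
    have "a * cos (\<theta>\<^sub>0 - s) * ?\<phi> 0 T - sin (\<theta>\<^sub>0 - s) * sin \<theta>\<^sub>0 / 2 * ?\<phi> (Suc 0) T =
        a * (cos (\<theta>\<^sub>0 - s) * (1 - a * T * hyp_sum m T a) + sin (\<theta>\<^sub>0 - s) * sin \<theta>\<^sub>0 / 2 * hyp_dsum m T a)"
      using T a m by (simp add: hyp_deriv_eq algebra_simps)
    then show ?thesis
      using zero beta_inner_conic_grad[OF that th] by (simp add: e_def T_def)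
  qed
  ultimately have "oblique_solution R \<theta>\<^sub>0 s ?u"
    unfolding oblique_solution_def by blast
  moreover have "holder_continuous_on (closure ?\<Omega>) ?u"
  proof -
    \<comment> \<open>As \<open>T < 1\<close>, the interval \<open>{0..T}\<close> lies inside the
      disc of convergence; bounds for the profile and its derivative there give the supremum bound
      \<open>M\<close> and the Lipschitz constant \<open>L\<close>.\<close>
    have "compact (?\<phi> j ` {0..T})" for j
      by (intro compact_continuous_image continuous_at_imp_continuous_on) (auto intro: cont)
    then have "\<exists>M>0. \<forall>t\<in>{0..T}. \<bar>?\<phi> j t\<bar> \<le> M" for j
      using compact_imp_bounded[of "?\<phi> j ` {0..T}"] by (auto simp: bounded_pos)
    then obtain M L where M: "M > 0" "\<And>t. t \<in> {0..T} \<Longrightarrow> \<bar>?\<phi> 0 t\<bar> \<le> M"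
      and L: "L > 0" "\<And>t. t \<in> {0..T} \<Longrightarrow> \<bar>?\<phi> (Suc 0) t\<bar> \<le> L"
      by metis
    have "\<bar>?\<phi> 0 s - ?\<phi> 0 t\<bar> \<le> L * \<bar>s - t\<bar>" if "s \<in> {0..T}" "t \<in> {0..T}" for s t
      unfolding real_norm_def[symmetric]
      by (rule field_differentiable_bound[of "{0..T}" _ "?\<phi> (Suc 0)"])
        (use that L in \<open>auto intro: deriv has_field_derivative_at_within\<close>)
    then show ?thesis
      using closure_cone_domain[OF th] M L T a
      by (intro holder_continuous_on_conic[OF e, of a _ T _ M L]) (auto simp: T_def e_def)
  qed
  moreover have "axisymmetric_on (closure ?\<Omega>) ?u"
    unfolding axisymmetric_on_def
    by (rule exI[of _ "\<lambda>y z. sqrt (z\<^sup>2 + y\<^sup>2) powr a * ?\<phi> 0 ((1 - y / sqrt (z\<^sup>2 + y\<^sup>2)) / 2)"])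
      (simp add: conic_def tilt_def e_def norm_prod_def inner_prod_def)
  \<comment> \<open>The axis segment lies in the domain because
    \<open>cos \<theta>\<^sub>0 < 1\<close>, and the profile equals 1 on it.\<close>
  moreover have "\<not> C1_upto ?\<Omega> (insert 0 ?\<Gamma>) ?u"
  proof (rule not_C1_upto_conic[OF e a \<open>0 < R\<close>])
    show "\<rho> *\<^sub>R e \<in> ?\<Omega>" if "0 < \<rho>" "\<rho> < R" for \<rho>
      using that e \<open>cos \<theta>\<^sub>0 < 1\<close> by (simp add: cone_domain_eq[OF th]) (simp add: e_def zero_prod_def)
    show "(?\<phi> 0 has_real_derivative ?\<phi> (Suc 0) 0) (at 0)"
      using T by (intro deriv) auto
    show "?\<phi> 0 0 \<noteq> 0"
      using m a by (simp add: hyp_deriv_eq)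
  qed
  ultimately show ?thesis
    unfolding singular_axisymmetric_solution_def e_def by blast
qed

text \<open>The function whose zero is sought is \<open>1 / a\<close> times the boundary operator. Its value at
  \<open>a = 1\<close> is \<open>cos s\<close>, since the profile for \<open>a = 1\<close> is \<open>cos \<theta>\<close>, i.e. the solution is \<open>x\<^sub>n\<close>.\<close>

lemma exists_homogeneity:
  fixes s :: real
  assumes th: "0 < \<theta>\<^sub>0" "\<theta>\<^sub>0 < pi" and m: "m \<ge> 1"
  defines "T \<equiv> (1 - cos \<theta>\<^sub>0) / 2"
  assumes "cos s < 0 \<and> 0 < cos (\<theta>\<^sub>0 - s) + sin (\<theta>\<^sub>0 - s) * sin \<theta>\<^sub>0 / 2 * hyp_dsum m T 0 \<or>
    cos s > 0 \<and> 0 > cos (\<theta>\<^sub>0 - s) + sin (\<theta>\<^sub>0 - s) * sin \<theta>\<^sub>0 / 2 * hyp_dsum m T 0"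
  shows "\<exists>a. 0 < a \<and> a < 1 \<and> cos (\<theta>\<^sub>0 - s) * (1 - a * T * hyp_sum m T a) +
    sin (\<theta>\<^sub>0 - s) * sin \<theta>\<^sub>0 / 2 * hyp_dsum m T a = 0"
proof -
  define H where "H a = cos (\<theta>\<^sub>0 - s) * (1 - a * T * hyp_sum m T a) +
    sin (\<theta>\<^sub>0 - s) * sin \<theta>\<^sub>0 / 2 * hyp_dsum m T a" for a
  have "-1 < cos \<theta>\<^sub>0" "cos \<theta>\<^sub>0 < 1"
    using cos_monotone_0_pi[of \<theta>\<^sub>0 pi] cos_monotone_0_pi[of 0 \<theta>\<^sub>0] th by auto
  then have T: "\<bar>T\<bar> < 1"
    by (auto simp: T_def)
  have H: "continuous_on {0..1} H"
    unfolding H_def using m T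
    by (intro continuous_intros continuous_hyp_sum continuous_hyp_dsum) auto
  have H0: "H 0 = cos (\<theta>\<^sub>0 - s) + sin (\<theta>\<^sub>0 - s) * sin \<theta>\<^sub>0 / 2 * hyp_dsum m T 0"
    by (simp add: H_def)
  have "1 - 2 * T = cos \<theta>\<^sub>0"
    by (simp add: T_def field_simps)
  have "H 1 = cos (\<theta>\<^sub>0 - s) * cos \<theta>\<^sub>0 + sin (\<theta>\<^sub>0 - s) * sin \<theta>\<^sub>0"
    using m \<open>1 - 2 * T = cos \<theta>\<^sub>0\<close> by (simp add: H_def hyp_sum_1 hyp_dsum_1 mult.commute)
  then have H1: "H 1 = cos s"
    using cos_diff[of \<theta>\<^sub>0 "\<theta>\<^sub>0 - s"] by (simp add: mult.commute)
  have "\<exists>a\<ge>0. a \<le> 1 \<and> H a = 0"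
    using IVT'[of H 0 0 1, OF _ _ _ H] IVT2'[of H 1 0 0, OF _ _ _ H] assms(5)
    unfolding H0[symmetric] H1[symmetric] by (elim disjE) auto
  \<comment> \<open>Nonzero endpoint values place the root strictly inside: \<open>a > 0\<close> is
    needed for Holder continuity, \<open>a < 1\<close> for the singular gradient.\<close>
  moreover have "H 0 \<noteq> 0" "H 1 \<noteq> 0"
    using assms H0 H1 by auto
  ultimately show ?thesis
    unfolding H_def by (metis order_le_less)
qed

section \<open>The choice of \<open>s\<^sub>0\<close> and the sign conditions\<close>

lemma negative_near:
  fixes f :: "real \<Rightarrow> real"
  assumes "isCont f c" "f c < 0" "c < d"
  shows "\<exists>s\<^sub>0\<in>{c<..<d}. \<forall>s\<in>{c<..<s\<^sub>0}. f s < 0"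
proof -
  have "\<forall>\<^sub>F s in at_right c. f s < 0"
    using assms by (intro order_tendstoD) (auto simp: isCont_def filterlim_at_split)
  then obtain b where b: "b > c" "\<And>s. c < s \<Longrightarrow> s < b \<Longrightarrow> f s < 0"
    using \<open>c < d\<close> by (auto simp: eventually_at_right[OF \<open>c < d\<close>])
  then show ?thesis
    \<comment> \<open>The minimum with the midpoint keeps the witness strictly below
      \<open>d\<close> even when \<open>b\<close> exceeds it.\<close>
    using assms(3) by (intro bexI[of _ "min b ((c + d) / 2)"]) (auto simp: min_def less_max_iff_disj min_less_iff_disj)
qed

theorem theorem1p2:
  fixes \<theta>\<^sub>0 :: real
  assumes "DIM((real^'m::finite) \<times> real) \<ge> 3"
    and "\<theta>\<^sub>0 \<in> {0<..<pi}"
  shows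
    "(\<theta>\<^sub>0 \<in> {pi / 2<..<pi} \<longrightarrow>
       (\<exists>s\<^sub>0\<in>{- pi + \<theta>\<^sub>0<..<0}. \<forall>R>0. \<forall>s\<in>{- pi + \<theta>\<^sub>0<..<\<theta>\<^sub>0}.
          s \<in> {- pi + \<theta>\<^sub>0<..<s\<^sub>0} \<or> s \<in> {pi / 2<..<\<theta>\<^sub>0} \<longrightarrow>
          (\<exists>u :: (real^'m) \<times> real \<Rightarrow> real. singular_axisymmetric_solution R \<theta>\<^sub>0 s u))) \<and>
     (\<theta>\<^sub>0 \<in> {0<..<pi / 2} \<longrightarrow>
       (\<exists>s\<^sub>0\<in>{- pi / 2<..<0}. \<forall>R>0. \<forall>s\<in>{- pi + \<theta>\<^sub>0<..<\<theta>\<^sub>0}.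
          s \<in> {- pi / 2<..<s\<^sub>0} \<longrightarrow>
          (\<exists>u :: (real^'m) \<times> real \<Rightarrow> real. singular_axisymmetric_solution R \<theta>\<^sub>0 s u)))"
proof (intro conjI impI)
  define m T where "m = real CARD('m)" and "T = (1 - cos \<theta>\<^sub>0) / 2"
  \<comment> \<open>The reduced boundary function at \<open>a = 0\<close>. It does not involve
    \<open>R\<close>, so an \<open>s\<^sub>0\<close> chosen from its sign serves all radii.\<close>
  define H where "H s = cos (\<theta>\<^sub>0 - s) + sin (\<theta>\<^sub>0 - s) * sin \<theta>\<^sub>0 / 2 * hyp_dsum m T 0" for s
  have th: "0 < \<theta>\<^sub>0" "\<theta>\<^sub>0 < pi"
    using assms by auto
  have m: "m \<ge> 1"
    unfolding m_def by (simp add: Suc_leI)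
  have sin: "0 < sin \<theta>\<^sub>0"
    using th by (rule sin_gt_zero)
  have cont: "isCont H s" for s
    unfolding H_def by (intro continuous_intros) simp_all
  have solution: "\<exists>u :: (real^'m) \<times> real \<Rightarrow> real. singular_axisymmetric_solution R \<theta>\<^sub>0 s u"
    if "0 < R" and Hs: "cos s < 0 \<and> 0 < H s \<or> cos s > 0 \<and> 0 > H s" for R s
  proof -
    obtain a where "0 < a" "a < 1" "cos (\<theta>\<^sub>0 - s) * (1 - a * T * hyp_sum m T a) +
        sin (\<theta>\<^sub>0 - s) * sin \<theta>\<^sub>0 / 2 * hyp_dsum m T a = 0"
      using exists_homogeneity[OF th m, of s] Hs unfolding H_def T_def by auto
    with \<open>0 < R\<close> show ?thesis
      using singular_axisymmetric_solution_conic[OF th, where 'm = 'm]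
      unfolding m_def T_def by blast
  qed
  {
    assume th2: "\<theta>\<^sub>0 \<in> {pi / 2<..<pi}"
    \<comment> \<open>Here \<open>\<theta>\<^sub>0 - s = pi\<close>, so the sine term drops out and
      the value is \<open>-1\<close>.\<close>
    have "H (- pi + \<theta>\<^sub>0) < 0"
      by (simp add: H_def)
    then obtain s\<^sub>0 where s\<^sub>0: "s\<^sub>0 \<in> {- pi + \<theta>\<^sub>0<..<0}" and neg: "\<forall>s\<in>{- pi + \<theta>\<^sub>0<..<s\<^sub>0}. H s < 0"
      using negative_near[OF cont, of "- pi + \<theta>\<^sub>0" 0] th by auto
    show "\<exists>s\<^sub>0\<in>{- pi + \<theta>\<^sub>0<..<0}. \<forall>R>0. \<forall>s\<in>{- pi + \<theta>\<^sub>0<..<\<theta>\<^sub>0}.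
        s \<in> {- pi + \<theta>\<^sub>0<..<s\<^sub>0} \<or> s \<in> {pi / 2<..<\<theta>\<^sub>0} \<longrightarrow>
        (\<exists>u :: (real^'m) \<times> real \<Rightarrow> real. singular_axisymmetric_solution R \<theta>\<^sub>0 s u)"
    proof (intro bexI[OF _ s\<^sub>0] allI ballI impI)
      fix R s :: real
      assume "0 < R" and s: "s \<in> {- pi + \<theta>\<^sub>0<..<s\<^sub>0} \<or> s \<in> {pi / 2<..<\<theta>\<^sub>0}"
      from s have "cos s < 0 \<and> 0 < H s \<or> cos s > 0 \<and> 0 > H s"
      proof
        assume "s \<in> {- pi + \<theta>\<^sub>0<..<s\<^sub>0}"
        then show ?thesis
          \<comment> \<open>As \<open>\<theta>\<^sub>0 > pi / 2\<close>, such \<open>s\<close> lies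
            between \<open>- pi / 2\<close> and 0, hence \<open>cos s > 0\<close>.\<close>
          using neg s\<^sub>0 th2 by (auto intro!: cos_gt_zero_pi)
      next
        \<comment> \<open>On this interval \<open>\<theta>\<^sub>0 - s\<close> lies between 0 and
          \<open>pi / 2\<close>, so \<open>H s\<close> is positive throughout while
          \<open>cos s\<close> is negative.\<close>
        assume s: "s \<in> {pi / 2<..<\<theta>\<^sub>0}"
        then have "cos s < cos (pi / 2)"
          using th by (intro cos_monotone_0_pi) auto
        moreover have "0 < cos (\<theta>\<^sub>0 - s)" "0 < sin (\<theta>\<^sub>0 - s)"
          using s th by (auto intro!: cos_gt_zero_pi sin_gt_zero)
        moreover have "0 \<le> T" "T < 1"
          using cos_monotone_0_pi[of \<theta>\<^sub>0 pi] th by (auto simp: T_def)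
        then have "0 \<le> hyp_dsum m T 0"
          using m by (intro hyp_dsum_nonneg) auto
        ultimately show ?thesis
          using sin by (auto simp: H_def intro!: add_pos_nonneg)
      qed
      with \<open>0 < R\<close> show "\<exists>u :: (real^'m) \<times> real \<Rightarrow> real. singular_axisymmetric_solution R \<theta>\<^sub>0 s u"
        by (rule solution)
    qed
  next
    assume th2: "\<theta>\<^sub>0 \<in> {0<..<pi / 2}"
    then have "0 < cos \<theta>\<^sub>0"
      by (intro cos_gt_zero_pi) auto
    then have "hyp_dsum m T 0 * (1 - 2 * T) < 2"
      using m by (intro hyp_dsum_0_less) (auto simp: T_def)
    moreover have "1 - 2 * T = cos \<theta>\<^sub>0"
      by (simp add: T_def field_simps)
    ultimately have "hyp_dsum m T 0 * cos \<theta>\<^sub>0 < 2"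
      by simp
    then have "sin \<theta>\<^sub>0 / 2 * (hyp_dsum m T 0 * cos \<theta>\<^sub>0) < sin \<theta>\<^sub>0 / 2 * 2"
      using sin by (intro mult_strict_left_mono) auto
    \<comment> \<open>At \<open>s = - pi / 2\<close> the shift by a quarter turn gives \<open>H s =
      sin \<theta>\<^sub>0 / 2 * hyp_dsum m T 0 * cos \<theta>\<^sub>0 - sin
      \<theta>\<^sub>0\<close>.\<close>
    then have "H (- pi / 2) < 0"
      by (simp add: H_def cos_add sin_add mult_ac)
    then obtain s\<^sub>0 where s\<^sub>0: "s\<^sub>0 \<in> {- pi / 2<..<0}" and neg: "\<forall>s\<in>{- pi / 2<..<s\<^sub>0}. H s < 0"
      using negative_near[OF cont, of "- pi / 2" 0] by auto
    have "cos s > 0" if "s \<in> {- pi / 2<..<s\<^sub>0}" for s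
      using that s\<^sub>0 by (auto intro!: cos_gt_zero_pi)
    then show "\<exists>s\<^sub>0\<in>{- pi / 2<..<0}. \<forall>R>0. \<forall>s\<in>{- pi + \<theta>\<^sub>0<..<\<theta>\<^sub>0}. s \<in> {- pi / 2<..<s\<^sub>0} \<longrightarrow>
        (\<exists>u :: (real^'m) \<times> real \<Rightarrow> real. singular_axisymmetric_solution R \<theta>\<^sub>0 s u)"
      using neg s\<^sub>0 solution by blast
  }
qed

end
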